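(* Let $(X,d)$ be a metric space. Then $(X,d)$ carries a Benjamini-Schramm lemma if and only if $(X,d)$ is doubling.
   Context: For a metric space $(X,d)$, $B(x,r)=\{y\in X: d(x,y)<r\}$ denotes the open ball. Isolation radius and supported points: let $C\subset X$ be a finite set of points and $w\in C$. The isolation radius of $w$ (with respect to $C$) is $\rho_w=\min\{d(w,v): v\in C\setminus\{w\}\}$. For $\delta\in(0,1)$ and $s\ge 2$, the point $w$ is called $(\delta,s)$-supported (in $C$) if $$\inf_{p\in X}\left|\left(B(w,\rho_w/\delta)\setminus B(p,\delta\rho_w)\right)\cap C\right|\ge s,$$ where $|\cdot|$ denotes cardinality. (If $C$ is a single point, $\rho_w$ is undefined and the point is regarded as not $(\delta,s)$-supported for any $\delta\in(0,1)$, $s\ge 2$; in any case the set whose cardinality is taken would have at most one element.) Benjamini-Schramm lemma: $(X,d)$ is said to carry a Benjamini-Schramm lemma if for every $\delta\in(0,1)$ there exists a constant $c=c(\delta)$ (depending only on $\delta$ and the space $(X,d)$) such that for every finite nonempty set $C\subset X$ and every $s\ge 2$, the number of $(\delta,s)$-supported points in $C$ is less than $c\,|C|/s$. Doubling: $(X,d)$ is called doubling if there is a constant $D\ge 1$ such that every set of (finite) diameter $r$ in $X$ can be covered by at most $D$ sets of diameter at most $r/2$. *)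

theory Defs
  imports "HOL-Analysis.Analysis"
begin

context Metric_space
begin

definition isolation_radius :: "'a set \<Rightarrow> 'a \<Rightarrow> real" where
  "isolation_radius C w = Min {d w v |v. v \<in> C - {w}}"

(* The conjunct C - {w} \<noteq> {} excludes the single-point case, where the Min above is
   unspecified. The INF is taken in nat and is therefore attained. The parameter s is real;
   this covers integer s, and replacing s by its ceiling does not change the notion. *)
definition supported :: "real \<Rightarrow> real \<Rightarrow> 'a set \<Rightarrow> 'a \<Rightarrow> bool" where
  "supported \<delta> s C w \<longleftrightarrow>
     w \<in> C \<and> C - {w} \<noteq> {} \<and>
     s \<le> real (INF p\<in>M. card ((mball w (isolation_radius C w / \<delta>)
                               - mball p (\<delta> * isolation_radius C w)) \<inter> C))"

definition benjamini_schramm :: bool where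
  "benjamini_schramm \<longleftrightarrow>
     (\<forall>\<delta>. 0 < \<delta> \<and> \<delta> < 1 \<longrightarrow>
       (\<exists>c::real. \<forall>C s. finite C \<and> C \<noteq> {} \<and> C \<subseteq> M \<and> 2 \<le> s \<longrightarrow>
          real (card {w \<in> C. supported \<delta> s C w}) < c * real (card C) / s))"

(* The analogue of the constant diameter of the class metric_space; meaningful only for
   bounded sets, as the supremum is unspecified otherwise. *)
definition mdiameter :: "'a set \<Rightarrow> real" where
  "mdiameter S = (if S = {} then 0 else SUP (x, y)\<in>S \<times> S. d x y)"

(* A bounded set is one of finite diameter; mbounded S also entails S \<subseteq> M. *)
definition doubling :: bool where
  "doubling \<longleftrightarrow>
     (\<exists>D::real. 1 \<le> D \<and>
       (\<forall>A. mbounded A \<longrightarrow>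
         (\<exists>\<F>. finite \<F> \<and> real (card \<F>) \<le> D \<and> A \<subseteq> \<Union>\<F> \<and>
              (\<forall>B\<in>\<F>. mbounded B \<and> mdiameter B \<le> mdiameter A / 2))))"

end

end

theory Submission
  imports Defs
begin

text \<open>
  If a set of diameter at most \<open>L\<close> contains many \<open>L/4\<close>-separated points, then every one of them is
  supported by all the others for \<open>\<delta> = 1/9\<close>; so a Benjamini-Schramm lemma bounds the number of such
  points, and a maximal separated set gives the doubling cover.

  Conversely, in a doubling space pigeonholing gives, for each \<open>(\<delta>, s)\<close>-supported point \<open>w\<close>, two balls
  of radius \<open>\<delta>\<rho>\<^sub>w/10\<close> near \<open>w\<close> that are \<open>\<delta>\<rho>\<^sub>w\<close> apart and contain at least \<open>s/K\<close> points of \<open>C\<close> each. Selecting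
  disjoint balls greedily, smallest radius first, yields a set \<open>P\<close> of at most \<open>K|C|/s\<close> centres such
  that each \<open>w\<close> sees two points of \<open>P\<close> whose distance is comparable to \<open>\<rho>\<^sub>w\<close>. Insert the points of
  \<open>P\<close> in farthest-first order: each such \<open>w\<close> is then close to a point of \<open>P\<close> whose insertion
  distance is comparable to \<open>\<rho>\<^sub>w\<close>. By doubling, a point of \<open>P\<close> is charged boundedly often, because
  supported points are \<open>\<rho>\<^sub>w\<close>-separated.
\<close>

section \<open>Greedy selection and pigeonhole counting\<close>

text \<open>Elements are taken by increasing \<open>f\<close> and kept unless they conflict with one
  already kept. A rejected element thus conflicts with one that came earlier, hence has no larger
  \<open>f\<close>.\<close>

lemma greedy_selection:
  fixes f :: "'i \<Rightarrow> real" and conflict :: "'i \<Rightarrow> 'i \<Rightarrow> bool"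
  assumes "finite I" and sym: "\<And>i j. conflict i j \<Longrightarrow> conflict j i"
  shows "\<exists>J\<subseteq>I. (\<forall>i\<in>J. \<forall>j\<in>J. i \<noteq> j \<longrightarrow> \<not> conflict i j) \<and>
           (\<forall>i\<in>I. \<exists>j\<in>J. f j \<le> f i \<and> (j = i \<or> conflict i j))"
  using assms(1)
proof (induction rule: finite_ranking_induct[where f = f])
  case empty
  then show ?case by simp
next
  case (insert x S)
  then obtain J where J: "J \<subseteq> S" "\<forall>i\<in>J. \<forall>j\<in>J. i \<noteq> j \<longrightarrow> \<not> conflict i j"
    "\<forall>i\<in>S. \<exists>j\<in>J. f j \<le> f i \<and> (j = i \<or> conflict i j)"
    by blast
  show ?case
  proof (cases "\<exists>j\<in>J. conflict x j")
    case True
    then have "\<exists>j\<in>J. f j \<le> f x \<and> (j = x \<or> conflict x j)"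
      using J(1) insert.hyps by blast
    then show ?thesis
      using J by (intro exI[of _ J]) auto
  next
    case False
    then show ?thesis
      using J sym by (intro exI[of _ "insert x J"]) (auto 4 4)
  qed
qed

lemma pigeonhole_cover:
  assumes "finite \<F>" "card \<F> \<le> K" "S \<subseteq> \<Union>\<F>" "finite S" "s \<le> real (card S)" "0 < s"
  shows "\<exists>B\<in>\<F>. s / real K \<le> real (card (B \<inter> S)) \<and> B \<inter> S \<noteq> {}"
proof (rule ccontr)
  assume *: "\<not> ?thesis"
  have S: "S = (\<Union>B\<in>\<F>. B \<inter> S)"
    using assms(3) by blast
  have "S \<noteq> {}"
    using assms by auto
  then have "\<F> \<noteq> {}"
    using assms(3) by auto
  then have "0 < card \<F>"
    using assms(1) by (simp add: card_gt_0_iff)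
  then have K: "0 < K"
    using assms(2) by linarith
  \<comment> \<open>The negated claim restricts only members that meet \<open>S\<close>; for the
    others the count is 0 and \<open>s / K\<close> is positive.\<close>
  have lt: "real (card (B \<inter> S)) < s / K" if "B \<in> \<F>" for B
  proof (cases "B \<inter> S = {}")
    case True
    then show ?thesis using K assms(6) by simp
  next
    case False
    then show ?thesis using * that by force
  qed
  have "card S \<le> (\<Sum>B\<in>\<F>. card (B \<inter> S))"
    using card_UN_le[OF assms(1), of "\<lambda>B. B \<inter> S"] S by simp
  then have "s \<le> (\<Sum>B\<in>\<F>. real (card (B \<inter> S)))"
    using assms(5) by (simp flip: of_nat_sum)
  also have "\<dots> < (\<Sum>B\<in>\<F>. s / K)"
    using \<open>\<F> \<noteq> {}\<close> assms(1) lt by (intro sum_strict_mono) auto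
  also have "\<dots> = real (card \<F>) * (s / K)"
    by simp
  also have "\<dots> \<le> real K * (s / K)"
    using assms by (intro mult_right_mono) auto
  also have "\<dots> = s"
    using K by simp
  finally show False by simp
qed

context Metric_space
begin

section \<open>Diameter, isolation radius and support\<close>

lemma dist_le_mdiameter:
  assumes "mbounded A" "x \<in> A" "y \<in> A"
  shows "d x y \<le> mdiameter A"
proof -
  obtain b where "\<forall>x\<in>A. \<forall>y\<in>A. d x y \<le> b"
    using assms(1) unfolding mbounded_alt by blast
  then have "bdd_above ((\<lambda>(x, y). d x y) ` (A \<times> A))"
    by (intro bdd_aboveI[of _ b]) auto
  then have "(\<lambda>(x, y). d x y) (x, y) \<le> (SUP (x, y)\<in>A \<times> A. d x y)"
    using assms by (intro cSUP_upper) auto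
  then show ?thesis
    using assms unfolding mdiameter_def by auto
qed

lemma mdiameter_le:
  assumes "0 \<le> b" "\<And>x y. x \<in> A \<Longrightarrow> y \<in> A \<Longrightarrow> d x y \<le> b"
  shows "mdiameter A \<le> b"
  unfolding mdiameter_def using assms by (auto intro!: cSUP_least)

lemma mdiameter_nonneg: "mbounded A \<Longrightarrow> 0 \<le> mdiameter A"
proof (cases "A = {}")
  case False
  then obtain x where "x \<in> A"
    by blast
  assume "mbounded A"
  then have "d x x \<le> mdiameter A"
    using \<open>x \<in> A\<close> by (intro dist_le_mdiameter)
  then show ?thesis
    using nonneg[of x x] by linarith
qed (simp add: mdiameter_def)

lemma isolation_radius_le:
  assumes "finite C" "v \<in> C" "v \<noteq> w"
  shows "isolation_radius C w \<le> d w v"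
proof -
  have "{d w v |v. v \<in> C - {w}} = d w ` (C - {w})"
    by blast
  then show ?thesis
    unfolding isolation_radius_def using assms by auto
qed

lemma isolation_radius_attained:
  assumes "finite C" "C - {w} \<noteq> {}"
  obtains v where "v \<in> C" "v \<noteq> w" "isolation_radius C w = d w v"
proof -
  have "{d w v |v. v \<in> C - {w}} = d w ` (C - {w})"
    by blast
  moreover have "Min (d w ` (C - {w})) \<in> d w ` (C - {w})"
    using assms by (intro Min_in) auto
  ultimately show ?thesis
    using that unfolding isolation_radius_def by auto
qed

lemma supported_card_le:
  assumes "supported \<delta> s C w" "p \<in> M"
  shows "s \<le> real (card ((mball w (isolation_radius C w / \<delta>)
                               - mball p (\<delta> * isolation_radius C w)) \<inter> C))"
proof -
  have "(INF p\<in>M. card ((mball w (isolation_radius C w / \<delta>)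
                               - mball p (\<delta> * isolation_radius C w)) \<inter> C))
      \<le> card ((mball w (isolation_radius C w / \<delta>)
                               - mball p (\<delta> * isolation_radius C w)) \<inter> C)"
    using assms(2) by (intro cINF_lower) auto
  then show ?thesis
    using assms(1) unfolding supported_def by linarith
qed

subsection \<open>Necessity of doubling\<close>

text \<open>For \<open>s\<close> one less than \<open>card C\<close> every point is supported:
  isolation radii lie between \<open>L / 4\<close> and \<open>L\<close>, so the large ball contains
  all of \<open>C\<close> and the removed ball at most one point. The Benjamini-Schramm bound then
  forces \<open>s < c\<close>.\<close>

lemma separated_card_le:
  assumes "finite C" "C \<subseteq> M" "0 < L"
    and sep: "\<And>x y. x \<in> C \<Longrightarrow> y \<in> C \<Longrightarrow> x \<noteq> y \<Longrightarrow> L / 4 < d x y"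
    and bound: "\<And>x y. x \<in> C \<Longrightarrow> y \<in> C \<Longrightarrow> d x y \<le> L"
    and c: "\<forall>C s. finite C \<and> C \<noteq> {} \<and> C \<subseteq> M \<and> 2 \<le> s \<longrightarrow>
          real (card {w \<in> C. supported (1/9) s C w}) < c * real (card C) / s"
  shows "real (card C) \<le> max 3 (c + 1)"
proof (rule ccontr)
  assume *: "\<not> ?thesis"
  define s where "s = real (card C) - 1"
  \<comment> \<open>The 3 in the maximum makes \<open>s\<close> an admissible threshold; the other
    entry gives the inequality to be contradicted.\<close>
  have s: "2 \<le> s" "c < s" and C3: "3 < card C"
    using * by (auto simp: s_def)
  have "C \<noteq> {}"
    using C3 by auto
  have "supported (1/9) s C w" if w: "w \<in> C" for w
  proof -
    let ?\<rho> = "isolation_radius C w"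
    have "card (C - {w}) \<noteq> 0"
      using C3 w assms(1) by simp
    then have ne: "C - {w} \<noteq> {}"
      by force
    obtain v where v: "v \<in> C" "v \<noteq> w" "?\<rho> = d w v"
      using isolation_radius_attained[OF assms(1) ne] .
    have \<rho>: "L / 4 < ?\<rho>" "?\<rho> \<le> L"
      using v sep[OF w v(1)] bound[OF w v(1)] by auto
    have "card C - 1 \<le> card ((mball w (?\<rho> / (1/9)) - mball p (1/9 * ?\<rho>)) \<inter> C)"
      if p: "p \<in> M" for p
    proof -
      have sub: "C \<subseteq> mball w (?\<rho> / (1/9))"
      proof
        fix x assume x: "x \<in> C"
        have "d w x \<le> L"
          using bound w x by blast
        then have "d w x < ?\<rho> / (1/9)"
          using \<rho> \<open>0 < L\<close> by (simp add: field_simps)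
        then show "x \<in> mball w (?\<rho> / (1/9))"
          using assms(2) w x by auto
      qed
      have one: "x = y" if x: "x \<in> C \<inter> mball p (1/9 * ?\<rho>)" and y: "y \<in> C \<inter> mball p (1/9 * ?\<rho>)" for x y
      proof (rule ccontr)
        assume "x \<noteq> y"
        then have "L / 4 < d x y"
          using sep x y by blast
        moreover have "d x y \<le> d p x + d p y"
          using x y triangle'[of x p y] commute by (auto simp: commute)
        \<comment> \<open>Two points of the removed ball are less than \<open>2/9 * L\<close> apart,
          and \<open>2/9 < 1/4\<close>.\<close>
        ultimately show False
          using x y \<rho> \<open>0 < L\<close> by auto
      qed
      have "card (C \<inter> mball p (1/9 * ?\<rho>)) \<le> 1"
        using one assms(1) by (simp add: card_le_Suc0_iff_eq)
      moreover have "(mball w (?\<rho> / (1/9)) - mball p (1/9 * ?\<rho>)) \<inter> C = C - (C \<inter> mball p (1/9 * ?\<rho>))"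
        using sub by blast
      ultimately show ?thesis
        using assms(1) by (simp add: card_Diff_subset)
    qed
    then have "card C - 1 \<le> (INF p\<in>M. card ((mball w (?\<rho> / (1/9)) - mball p (1/9 * ?\<rho>)) \<inter> C))"
      using \<open>C \<noteq> {}\<close> assms(2) by (intro cINF_greatest) auto
    then have "s \<le> real (INF p\<in>M. card ((mball w (?\<rho> / (1/9)) - mball p (1/9 * ?\<rho>)) \<inter> C))"
      unfolding s_def using C3 by linarith
    then show ?thesis
      unfolding supported_def using w ne by blast
  qed
  then have "{w \<in> C. supported (1/9) s C w} = C"
    by blast
  then have "real (card C) < c * real (card C) / s"
    using c[rule_format, of C s] assms s \<open>C \<noteq> {}\<close> by simp
  then have "real (card C) * s < c * real (card C)"
    using s by (simp add: field_simps)
  then show False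
    using s C3 by (simp add: mult.commute)
qed

text \<open>The cover consists of balls of a quarter of the diameter around a largest separated
  subset of \<open>A\<close>: a point outside all of them could be added to that subset.\<close>

lemma doubling_if_benjamini_schramm:
  assumes benjamini_schramm
  shows doubling
proof -
  obtain c :: real where c: "\<forall>C s. finite C \<and> C \<noteq> {} \<and> C \<subseteq> M \<and> 2 \<le> s \<longrightarrow>
          real (card {w \<in> C. supported (1/9) s C w}) < c * real (card C) / s"
  proof -
    have "(0::real) < 1/9 \<and> (1/9::real) < 1"
      by simp
    then have "\<exists>c::real. \<forall>C s. finite C \<and> C \<noteq> {} \<and> C \<subseteq> M \<and> 2 \<le> s \<longrightarrow>
          real (card {w \<in> C. supported (1/9) s C w}) < c * real (card C) / s"
      using assms unfolding benjamini_schramm_def by (elim allE[of _ "1/9"]) (rule mp)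
    then show ?thesis
      using that by (elim exE)
  qed
  define D where "D = max 3 (c + 1)"
  have "\<exists>\<F>. finite \<F> \<and> real (card \<F>) \<le> D \<and> A \<subseteq> \<Union>\<F> \<and>
              (\<forall>B\<in>\<F>. mbounded B \<and> mdiameter B \<le> mdiameter A / 2)" if A: "mbounded A" for A
  \<comment> \<open>Separation is measured at a positive scale; a set of diameter 0 covers
    itself.\<close>
  proof (cases "mdiameter A = 0")
    case True
    then show ?thesis
      using A by (intro exI[of _ "{A}"]) (auto simp: D_def)
  next
    case False
    define L where "L = mdiameter A"
    have L: "0 < L"
      using False mdiameter_nonneg[OF A] by (simp add: L_def)
    have AM: "A \<subseteq> M"
      using A mbounded_subset_mspace by blast
    define sep where
      "sep C \<longleftrightarrow> finite C \<and> C \<subseteq> A \<and> (\<forall>x\<in>C. \<forall>y\<in>C. x \<noteq> y \<longrightarrow> L / 4 < d x y)" for C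
    have D: "real (card C) \<le> D" if "sep C" for C
      unfolding D_def using that[unfolded sep_def] AM L dist_le_mdiameter[OF A]
      by (intro separated_card_le[OF _ _ _ _ _ c, of C L]) (auto simp: L_def)
    \<comment> \<open>This uniform bound is what makes a separated set of greatest cardinality
      exist.\<close>
    have "\<forall>C. sep C \<longrightarrow> card C < Suc (nat \<lceil>D\<rceil>)"
    proof (intro allI impI)
      fix C assume "sep C"
      then have "real (card C) \<le> D" by (rule D)
      then show "card C < Suc (nat \<lceil>D\<rceil>)" by linarith
    qed
    moreover have "sep {}" by (simp add: sep_def)
    ultimately have "\<exists>C. sep C \<and> (\<forall>C'. sep C' \<longrightarrow> card C' \<le> card C)"
      by (intro Lattices_Big.ex_has_greatest_nat[of sep "{}" card])
    then obtain C where sepC: "sep C" and max: "\<And>C'. sep C' \<Longrightarrow> card C' \<le> card C"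
      by blast
    have C: "finite C" "C \<subseteq> A" "\<forall>x\<in>C. \<forall>y\<in>C. x \<noteq> y \<longrightarrow> L / 4 < d x y"
      using sepC unfolding sep_def by auto
    let ?F = "(\<lambda>x. mcball x (L / 4) \<inter> A) ` C"
    have "A \<subseteq> \<Union>?F"
    proof
      fix a assume a: "a \<in> A"
      show "a \<in> \<Union>?F"
      proof (rule ccontr)
        assume no: "a \<notin> \<Union>?F"
        have far: "L / 4 < d x a" if "x \<in> C" for x
          using no that a C AM by (force simp: not_le)
        have "d a a = 0"
          using a AM by auto
        then have "a \<notin> C"
          using far[of a] L by auto
        moreover have "sep (insert a C)"
          unfolding sep_def using C far a by (auto simp: commute)
        ultimately show False
          using max[of "insert a C"] C by simp
      qed
    qed
    moreover have "mbounded B \<and> mdiameter B \<le> L / 2" if B: "B \<in> ?F" for B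
    proof
      obtain x where x: "x \<in> C" "B = mcball x (L / 4) \<inter> A"
        using B by blast
      show "mbounded B"
        using A x mbounded_subset by blast
      show "mdiameter B \<le> L / 2"
      proof (rule mdiameter_le)
        fix y z assume "y \<in> B" "z \<in> B"
        then have yz: "d x y \<le> L / 4" "d x z \<le> L / 4" "y \<in> M" "z \<in> M" "x \<in> M"
          using x by auto
        then show "d y z \<le> L / 2"
          using triangle[of y x z] commute[of y x] by linarith
      qed (use L in simp)
    qed
    moreover have "real (card ?F) \<le> D"
    proof -
      have "card ?F \<le> card C" using C card_image_le by blast
      then show ?thesis using D[OF sepC] by linarith
    qed
    ultimately show ?thesis
      using C unfolding L_def[symmetric] by (intro exI[of _ ?F]) auto
  qed
  then show ?thesis
    unfolding doubling_def by (intro exI[of _ D]) (auto simp: D_def)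
qed

subsection \<open>Sufficiency of doubling\<close>

text \<open>Any upper bound \<open>L\<close> on the distances takes the place of the diameter, so
  that the bound obtained for the pieces can be fed back in when covers are iterated.\<close>

definition uniform_cover :: "real \<Rightarrow> nat \<Rightarrow> bool" where
  "uniform_cover \<epsilon> K \<longleftrightarrow>
     (\<forall>A L. A \<subseteq> M \<longrightarrow> 0 \<le> L \<longrightarrow> (\<forall>x\<in>A. \<forall>y\<in>A. d x y \<le> L) \<longrightarrow>
       (\<exists>\<F>. finite \<F> \<and> card \<F> \<le> K \<and> A \<subseteq> \<Union>\<F> \<and>
          (\<forall>B\<in>\<F>. B \<subseteq> M \<and> (\<forall>x\<in>B. \<forall>y\<in>B. d x y \<le> \<epsilon> * L))))"

lemma uniform_coverD:
  assumes "uniform_cover \<epsilon> K" "A \<subseteq> M" "0 \<le> L" "\<And>x y. x \<in> A \<Longrightarrow> y \<in> A \<Longrightarrow> d x y \<le> L"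
  shows "\<exists>\<F>. finite \<F> \<and> card \<F> \<le> K \<and> A \<subseteq> \<Union>\<F> \<and>
          (\<forall>B\<in>\<F>. B \<subseteq> M \<and> (\<forall>x\<in>B. \<forall>y\<in>B. d x y \<le> \<epsilon> * L))"
proof -
  have "\<forall>x\<in>A. \<forall>y\<in>A. d x y \<le> L"
    using assms(4) by blast
  then show ?thesis
    by (rule assms(1)[unfolded uniform_cover_def, THEN spec, THEN spec, THEN mp, THEN mp, THEN mp,
          OF assms(2,3)])
qed

lemma uniform_cover_mono:
  assumes "uniform_cover \<epsilon> K" "\<epsilon> \<le> \<epsilon>'" "K \<le> K'"
  shows "uniform_cover \<epsilon>' K'"
  unfolding uniform_cover_def
proof (intro allI impI)
  fix A L assume A: "A \<subseteq> M" "0 \<le> L" "\<forall>x\<in>A. \<forall>y\<in>A. d x y \<le> L"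
  have "\<exists>\<F>. finite \<F> \<and> card \<F> \<le> K \<and> A \<subseteq> \<Union>\<F> \<and>
          (\<forall>B\<in>\<F>. B \<subseteq> M \<and> (\<forall>x\<in>B. \<forall>y\<in>B. d x y \<le> \<epsilon> * L))"
    using A by (intro uniform_coverD[OF assms(1)]) auto
  then obtain \<F> where F: "finite \<F>" "card \<F> \<le> K" "A \<subseteq> \<Union>\<F>"
    and FB: "\<forall>B\<in>\<F>. B \<subseteq> M \<and> (\<forall>x\<in>B. \<forall>y\<in>B. d x y \<le> \<epsilon> * L)"
    by (elim exE conjE) (rule that)
  have "\<epsilon> * L \<le> \<epsilon>' * L"
    using A(2) assms(2) by (rule mult_right_mono[rotated])
  then have "\<And>B x y. B \<in> \<F> \<Longrightarrow> x \<in> B \<Longrightarrow> y \<in> B \<Longrightarrow> d x y \<le> \<epsilon>' * L"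
    using FB order_trans by blast
  then show "\<exists>\<F>. finite \<F> \<and> card \<F> \<le> K' \<and> A \<subseteq> \<Union>\<F> \<and>
          (\<forall>B\<in>\<F>. B \<subseteq> M \<and> (\<forall>x\<in>B. \<forall>y\<in>B. d x y \<le> \<epsilon>' * L))"
    using F(1-3) FB assms(3) by (intro exI[of _ \<F>]) auto
qed

text \<open>Each piece of a first cover is covered again, with \<open>\<epsilon>1 * L\<close> as its
  distance bound.\<close>

lemma uniform_cover_compose:
  assumes "uniform_cover \<epsilon>1 K1" "uniform_cover \<epsilon>2 K2" "0 \<le> \<epsilon>1"
  shows "uniform_cover (\<epsilon>1 * \<epsilon>2) (K1 * K2)"
  unfolding uniform_cover_def
proof (intro allI impI)
  fix A L assume A: "A \<subseteq> M" "0 \<le> L" "\<forall>x\<in>A. \<forall>y\<in>A. d x y \<le> L"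
  have "\<exists>\<F>. finite \<F> \<and> card \<F> \<le> K1 \<and> A \<subseteq> \<Union>\<F> \<and>
          (\<forall>B\<in>\<F>. B \<subseteq> M \<and> (\<forall>x\<in>B. \<forall>y\<in>B. d x y \<le> \<epsilon>1 * L))"
    using A by (intro uniform_coverD[OF assms(1)]) auto
  then obtain \<F> where F: "finite \<F>" "card \<F> \<le> K1" "A \<subseteq> \<Union>\<F>"
    and FB: "\<forall>B\<in>\<F>. B \<subseteq> M \<and> (\<forall>x\<in>B. \<forall>y\<in>B. d x y \<le> \<epsilon>1 * L)"
    by (elim exE conjE) (rule that)
  have "\<exists>\<G>. finite \<G> \<and> card \<G> \<le> K2 \<and> B \<subseteq> \<Union>\<G> \<and>
      (\<forall>E\<in>\<G>. E \<subseteq> M \<and> (\<forall>x\<in>E. \<forall>y\<in>E. d x y \<le> \<epsilon>1 * \<epsilon>2 * L))" if B: "B \<in> \<F>" for B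
  proof -
    have "0 \<le> \<epsilon>1 * L"
      using A(2) assms(3) by simp
    then have "\<exists>\<G>. finite \<G> \<and> card \<G> \<le> K2 \<and> B \<subseteq> \<Union>\<G> \<and>
        (\<forall>E\<in>\<G>. E \<subseteq> M \<and> (\<forall>x\<in>E. \<forall>y\<in>E. d x y \<le> \<epsilon>2 * (\<epsilon>1 * L)))"
      using FB B by (intro uniform_coverD[OF assms(2)]) auto
    then show ?thesis
      by (simp add: mult_ac)
  qed
  then obtain G where G: "\<And>B. B \<in> \<F> \<Longrightarrow> finite (G B) \<and> card (G B) \<le> K2 \<and> B \<subseteq> \<Union>(G B) \<and>
      (\<forall>E\<in>G B. E \<subseteq> M \<and> (\<forall>x\<in>E. \<forall>y\<in>E. d x y \<le> \<epsilon>1 * \<epsilon>2 * L))"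
    by metis
  have "card (\<Union>B\<in>\<F>. G B) \<le> (\<Sum>B\<in>\<F>. card (G B))"
    using F(1) by (rule card_UN_le)
  also have "\<dots> \<le> card \<F> * K2"
    using G sum_bounded_above[of \<F> "\<lambda>B. card (G B)" K2] by simp
  also have "\<dots> \<le> K1 * K2"
    using F(2) by simp
  finally have "card (\<Union>B\<in>\<F>. G B) \<le> K1 * K2" .
  moreover have "A \<subseteq> \<Union>(\<Union>B\<in>\<F>. G B)"
  proof
    fix a assume "a \<in> A"
    then obtain B where B: "B \<in> \<F>" "a \<in> B"
      using F(3) by blast
    then have "a \<in> \<Union>(G B)"
      using G[OF B(1)] by (elim conjE) (rule subsetD)
    then show "a \<in> \<Union>(\<Union>B\<in>\<F>. G B)"
      using B(1) by blast
  qed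
  moreover have "finite (\<Union>B\<in>\<F>. G B)"
    using F(1) G by (intro finite_UN_I) auto
  moreover have "E \<subseteq> M \<and> (\<forall>x\<in>E. \<forall>y\<in>E. d x y \<le> \<epsilon>1 * \<epsilon>2 * L)" if E: "E \<in> (\<Union>B\<in>\<F>. G B)" for E
  proof -
    obtain B where "B \<in> \<F>" "E \<in> G B"
      using E by blast
    then show ?thesis
      using G[of B] by simp
  qed
  ultimately show "\<exists>\<F>. finite \<F> \<and> card \<F> \<le> K1 * K2 \<and> A \<subseteq> \<Union>\<F> \<and>
          (\<forall>B\<in>\<F>. B \<subseteq> M \<and> (\<forall>x\<in>B. \<forall>y\<in>B. d x y \<le> \<epsilon>1 * \<epsilon>2 * L))"
    by (intro exI[of _ "\<Union>B\<in>\<F>. G B"] conjI ballI) simp_all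
qed

lemma uniform_cover_half:
  assumes doubling
  obtains K where "uniform_cover (1/2) K"
proof -
  obtain D :: real where D: "\<And>A. mbounded A \<Longrightarrow> \<exists>\<F>. finite \<F> \<and> real (card \<F>) \<le> D \<and> A \<subseteq> \<Union>\<F> \<and>
              (\<forall>B\<in>\<F>. mbounded B \<and> mdiameter B \<le> mdiameter A / 2)"
    using assms unfolding doubling_def by blast
  have "uniform_cover (1/2) (nat \<lceil>D\<rceil>)"
    unfolding uniform_cover_def
  proof (intro allI impI)
    fix A L assume A: "A \<subseteq> M" "0 \<le> L" "\<forall>x\<in>A. \<forall>y\<in>A. d x y \<le> L"
    have "mbounded A"
      using A unfolding mbounded_alt by blast
    then obtain \<F> where F: "finite \<F>" "real (card \<F>) \<le> D" "A \<subseteq> \<Union>\<F>"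
        "\<forall>B\<in>\<F>. mbounded B \<and> mdiameter B \<le> mdiameter A / 2"
      using D by blast
    have "mdiameter A \<le> L"
      using A by (intro mdiameter_le) auto
    then have "d x y \<le> 1/2 * L" if "B \<in> \<F>" "x \<in> B" "y \<in> B" for B x y
      using F(4) that dist_le_mdiameter[of B x y] by fastforce
    moreover have "card \<F> \<le> nat \<lceil>D\<rceil>"
      using F(2) by linarith
    ultimately show "\<exists>\<F>. finite \<F> \<and> card \<F> \<le> nat \<lceil>D\<rceil> \<and> A \<subseteq> \<Union>\<F> \<and>
          (\<forall>B\<in>\<F>. B \<subseteq> M \<and> (\<forall>x\<in>B. \<forall>y\<in>B. d x y \<le> 1/2 * L))"
      using F mbounded_subset_mspace by (intro exI[of _ \<F>]) blast
  qed
  then show ?thesis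
    by (rule that)
qed

text \<open>Halving is iterated until the factor \<open>(1/2) ^ n\<close> drops below
  \<open>\<epsilon>\<close>.\<close>

lemma uniform_cover_if_doubling:
  assumes doubling "0 < \<epsilon>"
  obtains K where "uniform_cover \<epsilon> K"
proof -
  obtain n where n: "(1/2) ^ n < \<epsilon>"
    using assms(2) real_arch_pow_inv[of \<epsilon> "1/2"] by auto
  obtain K where K: "uniform_cover (1/2) K"
    using uniform_cover_half[OF assms(1)] .
  have "uniform_cover ((1/2) ^ n) (K ^ n)" for n
  proof (induction n)
    case 0
    show ?case
      unfolding uniform_cover_def by (intro allI impI, rule_tac x = "{A}" in exI) auto
  next
    case (Suc n)
    show ?case
      using uniform_cover_compose[OF K Suc] by simp
  qed
  then show ?thesis
    using uniform_cover_mono[OF _ less_imp_le[OF n] order_refl] that by blast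
qed

section \<open>Farthest-first nets\<close>

text \<open>The witness \<open>z\<close> is a point of \<open>P\<close> farthest from
  \<open>Q\<close>, the next to be inserted, and \<open>t\<close> is its distance to
  \<open>Q\<close>.\<close>

lemma covering_radius:
  assumes "finite P" "finite Q" "P \<noteq> {}" "Q \<noteq> {}"
  obtains t z where "\<And>p. p \<in> P \<Longrightarrow> \<exists>q\<in>Q. d p q \<le> t" "z \<in> P" "\<And>q. q \<in> Q \<Longrightarrow> t \<le> d z q"
proof -
  define m where "m p = Min (d p ` Q)" for p
  have m: "m p \<in> d p ` Q" "\<And>q. q \<in> Q \<Longrightarrow> m p \<le> d p q" for p
    using assms by (auto simp: m_def)
  have "Max (m ` P) \<in> m ` P"
    using assms by (intro Max_in) auto
  then obtain z where z: "z \<in> P" "Max (m ` P) = m z"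
    by auto
  have le: "m p \<le> m z" if "p \<in> P" for p
    using that assms(1) z(2) by (metis Max_ge finite_imageI imageI)
  have "\<exists>q\<in>Q. d p q \<le> m z" if "p \<in> P" for p
    using m(1)[of p] le[OF that] by auto
  then show ?thesis
    using that z(1) m(2)[of _ z] by blast
qed

text \<open>Here \<open>R x\<close> is the distance of \<open>x\<close> to the points inserted before it when the points are
  inserted in farthest-first order, so \<open>{x. r \<le> R x}\<close> is an \<open>r\<close>-net for every \<open>r\<close> at once.\<close>

lemma farthest_first_radii:
  assumes "finite P" "P \<subseteq> M" and B: "\<And>x y. x \<in> P \<Longrightarrow> y \<in> P \<Longrightarrow> d x y \<le> B"
  obtains R where "\<And>x y. x \<in> P \<Longrightarrow> y \<in> P \<Longrightarrow> x \<noteq> y \<Longrightarrow> min (R x) (R y) \<le> d x y"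
    and "\<And>p r. p \<in> P \<Longrightarrow> 0 < r \<Longrightarrow> r \<le> B \<Longrightarrow> \<exists>q\<in>P. r \<le> R q \<and> d p q < r"
proof (cases "P = {}")
  case True
  then show ?thesis using that by auto
next
  case False
  \<comment> \<open>\<open>Q\<close> holds the points inserted so far and \<open>t\<close> is its
    covering radius. No radius assigned so far is below \<open>t\<close>, and the net property is
    claimed only for scales above \<open>t\<close>.\<close>
  define inv where "inv Q R t \<longleftrightarrow> Q \<subseteq> P \<and> Q \<noteq> {} \<and> (\<forall>p\<in>P. \<exists>q\<in>Q. d p q \<le> t) \<and>
      (\<exists>z\<in>P. \<forall>q\<in>Q. t \<le> d z q) \<and> (\<forall>q\<in>Q. t \<le> R q) \<and>
      (\<forall>x\<in>Q. \<forall>y\<in>Q. x \<noteq> y \<longrightarrow> min (R x) (R y) \<le> d x y) \<and>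
      (\<forall>p\<in>P. \<forall>r. t < r \<and> r \<le> B \<longrightarrow> (\<exists>q\<in>Q. r \<le> R q \<and> d p q < r))" for Q t and R :: "'a \<Rightarrow> real"
  have "\<exists>Q R t. inv Q R t \<and> (Suc k \<le> card Q \<or> Q = P)" for k
  proof (induction k)
    case 0
    obtain a where a: "a \<in> P" using False by blast
    obtain t z where t: "\<And>p. p \<in> P \<Longrightarrow> \<exists>q\<in>{a}. d p q \<le> t" "z \<in> P" "\<And>q. q \<in> {a} \<Longrightarrow> t \<le> d z q"
      using covering_radius[of P "{a}"] assms(1) False by (metis finite.emptyI finite.insertI insert_not_empty)
    have "t \<le> B"
      using t(3)[of a] B[OF t(2) a] by simp
    \<comment> \<open>The first point has no predecessor; radius \<open>B\<close> puts it into the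
      net at every admissible scale.\<close>
    then have "inv {a} (\<lambda>_. B) t"
      unfolding inv_def using a t by fastforce
    then show ?case by force
  next
    case (Suc k)
    then obtain Q R t where Q: "inv Q R t" "Suc k \<le> card Q \<or> Q = P"
      by blast
    have QP: "Q \<subseteq> P" "Q \<noteq> {}" and cov: "\<forall>p\<in>P. \<exists>q\<in>Q. d p q \<le> t" and Rt: "\<forall>q\<in>Q. t \<le> R q"
      and sep: "\<forall>x\<in>Q. \<forall>y\<in>Q. x \<noteq> y \<longrightarrow> min (R x) (R y) \<le> d x y"
      and net: "\<forall>p\<in>P. \<forall>r. t < r \<and> r \<le> B \<longrightarrow> (\<exists>q\<in>Q. r \<le> R q \<and> d p q < r)"
      using Q(1) unfolding inv_def by auto
    obtain z where z: "z \<in> P" "\<forall>q\<in>Q. t \<le> d z q"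
      using Q(1) unfolding inv_def by auto
    show ?case
    proof (cases "z \<in> Q")
      case True
      \<comment> \<open>A farthest point already in \<open>Q\<close> is at distance 0 from it, so
        \<open>Q\<close> exhausts \<open>P\<close>.\<close>
      then have "t \<le> 0"
        using z assms(2) by fastforce
      have "P \<subseteq> Q"
      proof
        fix p assume p: "p \<in> P"
        then obtain q where "q \<in> Q" "d p q \<le> t" using cov by blast
        then have "d p q = 0" "q \<in> M" "p \<in> M"
          using \<open>t \<le> 0\<close> nonneg[of p q] p QP assms(2) by (linarith, auto)
        then show "p \<in> Q" using \<open>q \<in> Q\<close> by simp
      qed
      then show ?thesis using Q QP by blast
    next
      case zQ: False
      define Q' where "Q' = insert z Q"
      define R' where "R' = R(z := t)"
      have finQ: "finite Q" using QP assms(1) finite_subset by blast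
      obtain t' z' where t': "\<And>p. p \<in> P \<Longrightarrow> \<exists>q\<in>Q'. d p q \<le> t'" "z' \<in> P" "\<And>q. q \<in> Q' \<Longrightarrow> t' \<le> d z' q"
        using covering_radius[of P Q'] assms(1) False finQ unfolding Q'_def
        by (metis finite.insertI insert_not_empty)
      have "t' \<le> t"
        using cov t'(2) t'(3) unfolding Q'_def by (meson insertI2 order_trans)
      have R'Q: "R' q = R q" if "q \<in> Q" for q
        using that zQ by (auto simp: R'_def)
      have R'z: "R' z = t" by (simp add: R'_def)
      have R't: "t \<le> R' q" if "q \<in> Q'" for q
        using that R'Q R'z Rt unfolding Q'_def by fastforce
      have sep': "min (R' x) (R' y) \<le> d x y" if "x \<in> Q'" "y \<in> Q'" "x \<noteq> y" for x y
      proof -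
        consider "x = z" "y \<in> Q" | "y = z" "x \<in> Q" | "x \<in> Q" "y \<in> Q"
          using \<open>x \<in> Q'\<close> \<open>y \<in> Q'\<close> \<open>x \<noteq> y\<close> unfolding Q'_def by blast
        then show ?thesis
        proof cases
          case 1
          then show ?thesis using z R'z by (simp add: min.coboundedI1)
        next
          case 2
          then show ?thesis using z R'z commute[of x z] by (simp add: min.coboundedI2)
        next
          case 3
          then show ?thesis using sep R'Q that(3) by simp
        qed
      qed
      \<comment> \<open>Scales above \<open>t\<close> are served by the old points. For
        \<open>t' < r \<le> t\<close> every point of \<open>Q'\<close> has radius at least
        \<open>r\<close>, and one of them is within \<open>t'\<close>.\<close>
      have net': "\<exists>q\<in>Q'. r \<le> R' q \<and> d p q < r" if h: "p \<in> P" "t' < r" "r \<le> B" for p r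
      proof (cases "t < r")
        case True
        then obtain q where "q \<in> Q" "r \<le> R q" "d p q < r" using net h by blast
        then show ?thesis using R'Q unfolding Q'_def by (metis insertI2)
      next
        case False
        obtain q where "q \<in> Q'" "d p q \<le> t'" using t'(1) h by blast
        then show ?thesis using R't[of q] False h by force
      qed
      have "inv Q' R' t'"
        unfolding inv_def
      proof (intro conjI ballI)
        show "Q' \<subseteq> P" "Q' \<noteq> {}" using z QP by (auto simp: Q'_def)
        show "\<exists>z\<in>P. \<forall>q\<in>Q'. t' \<le> d z q" using t' by blast
        show "t' \<le> R' q" if "q \<in> Q'" for q using R't[OF that] \<open>t' \<le> t\<close> by linarith
      qed (use t' sep' net' in auto)
      moreover have "Suc (Suc k) \<le> card Q'"
        using Q(2) zQ z(1) finQ by (auto simp: Q'_def)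
      ultimately show ?thesis by blast
    qed
  qed
  then obtain Q R t where Q: "inv Q R t" "Suc (card P) \<le> card Q \<or> Q = P"
    by blast
  have "Q \<subseteq> P" using Q(1) unfolding inv_def by (rule conjunct1)
  then have "card Q \<le> card P" using assms(1) by (simp add: card_mono)
  then have [simp]: "Q = P" using Q(2) by simp
  have inv: "inv P R t"
    using Q(1) by simp
  then have "\<exists>z\<in>P. \<forall>q\<in>P. t \<le> d z q"
    unfolding inv_def by (elim conjE)
  then obtain z where "z \<in> P" "t \<le> d z z"
    by blast
  \<comment> \<open>With all points inserted the net property reaches every positive scale.\<close>
  then have "t \<le> 0"
    using assms(2) by (simp add: subset_iff)
  have "\<forall>x\<in>P. \<forall>y\<in>P. x \<noteq> y \<longrightarrow> min (R x) (R y) \<le> d x y"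
    using inv unfolding inv_def by (elim conjE)
  moreover have "\<forall>p\<in>P. \<forall>r. t < r \<and> r \<le> B \<longrightarrow> (\<exists>q\<in>P. r \<le> R q \<and> d p q < r)"
    using inv unfolding inv_def by (elim conjE)
  then have "\<exists>q\<in>P. r \<le> R q \<and> d p q < r" if "p \<in> P" "0 < r" "r \<le> B" for p r
    using that \<open>t \<le> 0\<close> by (meson le_less_trans)
  ultimately show ?thesis
    using that[of R] by blast
qed

section \<open>Heavy balls and nearby net points\<close>

text \<open>Greedy selection by radius keeps balls with disjoint traces on \<open>C\<close>, so
  their number times \<open>s\<close> is at most \<open>card C\<close>. Every ball meets a kept one
  of no larger radius, which puts the centres within \<open>2 * r\<close>.\<close>

lemma heavy_balls_packing:
  fixes I :: "('a \<times> real) set"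
  assumes "finite C" "C \<subseteq> M" "finite I" "0 < s"
    and I: "\<And>x r. (x, r) \<in> I \<Longrightarrow> x \<in> C \<and> s \<le> real (card (mcball x r \<inter> C))"
  obtains P where "P \<subseteq> C" "real (card P) * s \<le> real (card C)"
    "\<And>x r. (x, r) \<in> I \<Longrightarrow> \<exists>p\<in>P. d x p \<le> 2 * r"
proof -
  define ball where "ball i = mcball (fst i) (snd i) \<inter> C" for i
  obtain J where J: "J \<subseteq> I"
    "\<forall>i\<in>J. \<forall>j\<in>J. i \<noteq> j \<longrightarrow> \<not> ball i \<inter> ball j \<noteq> {}"
    "\<forall>i\<in>I. \<exists>j\<in>J. snd j \<le> snd i \<and> (j = i \<or> ball i \<inter> ball j \<noteq> {})"
    using greedy_selection[OF assms(3), of "\<lambda>i j. ball i \<inter> ball j \<noteq> {}" snd]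
    by (auto simp: Int_commute)
  have finJ: "finite J"
    using J(1) assms(3) finite_subset by blast
  have ball: "s \<le> real (card (ball i))" "finite (ball i)" if "i \<in> I" for i
    using I[of "fst i" "snd i"] that assms(1) by (auto simp: ball_def)
  have disj: "\<forall>i\<in>J. \<forall>j\<in>J. i \<noteq> j \<longrightarrow> ball i \<inter> ball j = {}"
    using J(2) by simp
  have "real (card J) * s = (\<Sum>i\<in>J. s)"
    by simp
  also have "\<dots> \<le> (\<Sum>i\<in>J. real (card (ball i)))"
    using J(1) ball by (intro sum_mono) blast
  also have "\<dots> = real (card (\<Union>i\<in>J. ball i))"
    using finJ J(1) ball(2) disj by (subst card_UN_disjoint) auto
  also have "\<dots> \<le> real (card C)"
    using assms(1) by (intro of_nat_mono card_mono) (auto simp: ball_def)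
  finally have "real (card J) * s \<le> real (card C)" .
  moreover have "real (card (fst ` J)) * s \<le> real (card J) * s"
    using assms(4) card_image_le[OF finJ] by (intro mult_right_mono) auto
  moreover have "fst ` J \<subseteq> C"
    using J(1) I by force
  moreover have "\<exists>p\<in>fst ` J. d x p \<le> 2 * r" if i: "(x, r) \<in> I" for x r
  proof -
    obtain j where j: "j \<in> J" "snd j \<le> r" "j = (x, r) \<or> ball (x, r) \<inter> ball j \<noteq> {}"
      using J(3) i by force
    \<comment> \<open>A nonempty ball meets itself, so a kept ball needs no separate case.\<close>
    have "ball (x, r) \<noteq> {}"
      using ball(1)[OF i] assms(4) by auto
    then obtain y where "y \<in> ball (x, r)" "y \<in> ball j"
      using j(3) by blast
    then have y: "d x y \<le> r" "d (fst j) y \<le> snd j" "x \<in> M" "y \<in> M" "fst j \<in> M"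
      by (auto simp: ball_def)
    then have "d x (fst j) \<le> 2 * r"
      using triangle[of x y "fst j"] commute[of y "fst j"] j(2) by linarith
    then show ?thesis
      using j(1) by blast
  qed
  ultimately show ?thesis
    using that[of "fst ` J"] by (meson order_trans)
qed

text \<open>The net at scale \<open>r\<close> has points \<open>p'\<close>, \<open>q'\<close> within
  \<open>r\<close> of \<open>p\<close> and \<open>q\<close>. They differ since
  \<open>2 * r < d p q\<close>, so separation bounds the smaller of their radii by
  \<open>d p' q'\<close>, and the point carrying it is \<open>z\<close>.\<close>

lemma radius_near_pair:
  assumes "P \<subseteq> M" "p \<in> P" "q \<in> P" "0 < r" "2 * r < d p q"
    and B: "\<And>x y. x \<in> P \<Longrightarrow> y \<in> P \<Longrightarrow> d x y \<le> B"
    and sep: "\<And>x y. x \<in> P \<Longrightarrow> y \<in> P \<Longrightarrow> x \<noteq> y \<Longrightarrow> min (R x) (R y) \<le> d x y"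
    and net: "\<And>p r. p \<in> P \<Longrightarrow> 0 < r \<Longrightarrow> r \<le> B \<Longrightarrow> \<exists>q\<in>P. r \<le> R q \<and> d p q < r"
  shows "\<exists>z\<in>P. r \<le> R z \<and> R z \<le> d p q + 2 * r \<and> d p z \<le> d p q + r"
proof -
  have "r \<le> B"
    using B[OF assms(2,3)] assms(4,5) by linarith
  then obtain p' q' where *: "p' \<in> P" "r \<le> R p'" "d p p' < r" "q' \<in> P" "r \<le> R q'" "d q q' < r"
    using net[OF assms(2,4)] net[OF assms(3,4)] by blast
  have M: "p \<in> M" "q \<in> M" "p' \<in> M" "q' \<in> M"
    using * assms by auto
  have "d p q' \<le> d p q + d q q'" "d p' q' \<le> d p' p + d p q'" "d p q \<le> d p q' + d q' q"
    using M by (auto intro: triangle)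
  then have tri: "d p q' \<le> d p q + r" "d p' q' \<le> d p q + 2 * r" "d p q \<le> d p q' + r"
    using * commute[of p' p] commute[of q' q] by linarith+
  have "p' \<noteq> q'"
    using tri(3) *(3) assms(5) by auto
  then have "min (R p') (R q') \<le> d p q + 2 * r"
    using sep[of p' q'] * tri(2) by linarith
  then consider "R p' \<le> d p q + 2 * r" | "R q' \<le> d p q + 2 * r"
    by (auto simp: min_le_iff_disj)
  then show ?thesis
  proof cases
    case 1
    then show ?thesis using * nonneg[of p q] by (intro bexI[of _ p']) linarith+
  next
    case 2
    then show ?thesis using * tri by (intro bexI[of _ q']) linarith+
  qed
qed

text \<open>Pigeonhole on a fine cover of the large ball gives a heavy piece around some
  \<open>x\<close>. Support with \<open>p = x\<close> leaves \<open>s\<close> points outside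
  \<open>mball x (\<delta> * \<rho>)\<close>, and a second pigeonhole among these gives
  \<open>y\<close>.\<close>

lemma supported_two_heavy_balls:
  assumes "finite C" "C \<subseteq> M" "0 < \<delta>" "0 < s" "supported \<delta> s C w"
    and K: "uniform_cover (\<delta>\<^sup>2 / 20) K"
    and \<rho>: "\<rho> = isolation_radius C w" "0 < \<rho>"
  shows "\<exists>x\<in>C. \<exists>y\<in>C. d w x < \<rho> / \<delta> \<and> d w y < \<rho> / \<delta> \<and> \<delta> * \<rho> \<le> d x y \<and>
     s / real K \<le> real (card (mcball x (\<delta> * \<rho> / 10) \<inter> C)) \<and>
     s / real K \<le> real (card (mcball y (\<delta> * \<rho> / 10) \<inter> C))"
proof -
  have w: "w \<in> C" "w \<in> M"
    using assms unfolding supported_def by auto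
  define S where "S = mball w (\<rho> / \<delta>) \<inter> C"
  have S: "S \<subseteq> M" "finite S" "S \<subseteq> C"
    using assms by (auto simp: S_def)
  have S2: "d x y \<le> 2 * \<rho> / \<delta>" if "x \<in> S" "y \<in> S" for x y
  proof -
    have "d w x < \<rho> / \<delta>" "d w y < \<rho> / \<delta>" "x \<in> M" "y \<in> M"
      using that by (auto simp: S_def)
    then show ?thesis
      using triangle[of x w y] w commute[of x w] by auto
  qed
  obtain \<F> where F: "finite \<F>" "card \<F> \<le> K" "S \<subseteq> \<Union>\<F>"
      "\<And>B x y. B \<in> \<F> \<Longrightarrow> x \<in> B \<Longrightarrow> y \<in> B \<Longrightarrow> d x y \<le> \<delta>\<^sup>2 / 20 * (2 * \<rho> / \<delta>)"
    using uniform_coverD[OF K S(1) _ S2] assms(3) \<rho>(2) by (auto simp del: times_divide_eq_right)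
  \<comment> \<open>The factor in the cover is chosen so that its pieces fit into balls of radius
    \<open>\<delta> * \<rho> / 10\<close> about any of their points.\<close>
  have eq: "\<delta>\<^sup>2 / 20 * (2 * \<rho> / \<delta>) = \<delta> * \<rho> / 10"
    using assms(3) by (simp add: field_simps power2_eq_square)
  have heavy: "\<exists>x\<in>T. s / real K \<le> real (card (mcball x (\<delta> * \<rho> / 10) \<inter> C))"
    if T: "T \<subseteq> S" "s \<le> real (card T)" for T
  proof -
    have finT: "finite T" "T \<subseteq> \<Union>\<F>"
      using T(1) S(2) F(3) by (auto dest: finite_subset)
    obtain B where B: "B \<in> \<F>" "s / real K \<le> real (card (B \<inter> T))" "B \<inter> T \<noteq> {}"
      using pigeonhole_cover[OF F(1,2) finT(2,1) T(2) assms(4)] by blast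
    then obtain x where x: "x \<in> B" "x \<in> T"
      by blast
    have "B \<inter> T \<subseteq> mcball x (\<delta> * \<rho> / 10) \<inter> C"
    proof
      fix y assume y: "y \<in> B \<inter> T"
      then have "d x y \<le> \<delta> * \<rho> / 10"
        using F(4)[OF B(1) x(1), of y] unfolding eq by blast
      then show "y \<in> mcball x (\<delta> * \<rho> / 10) \<inter> C"
        using x y T S by auto
    qed
    then have "card (B \<inter> T) \<le> card (mcball x (\<delta> * \<rho> / 10) \<inter> C)"
      using assms(1) by (intro card_mono) auto
    then show ?thesis
      using x B(2) by (intro bexI[of _ x]) linarith+
  qed
  have far: "s \<le> real (card (S - mball p (\<delta> * \<rho>)))" if "p \<in> M" for p
  proof -
    have "(mball w (\<rho> / \<delta>) - mball p (\<delta> * \<rho>)) \<inter> C = S - mball p (\<delta> * \<rho>)"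
      by (auto simp: S_def)
    then show ?thesis
      using supported_card_le[OF assms(5) that] unfolding \<rho>(1)[symmetric] by simp
  qed
  \<comment> \<open>Here the centre \<open>w\<close> is an arbitrary choice; only
    \<open>s \<le> card S\<close> is wanted.\<close>
  have "card (S - mball w (\<delta> * \<rho>)) \<le> card S"
    using S(2) by (intro card_mono) auto
  then have "s \<le> real (card S)"
    using far[OF w(2)] by linarith
  then obtain x where x: "x \<in> S" "s / real K \<le> real (card (mcball x (\<delta> * \<rho> / 10) \<inter> C))"
    using heavy[of S] by blast
  have "x \<in> M"
    using x S by blast
  obtain y where y: "y \<in> S - mball x (\<delta> * \<rho>)" "s / real K \<le> real (card (mcball y (\<delta> * \<rho> / 10) \<inter> C))"
    using heavy[OF _ far[OF \<open>x \<in> M\<close>]] by blast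
  have "\<delta> * \<rho> \<le> d x y"
    using y(1) \<open>x \<in> M\<close> S by (auto simp: not_less)
  then show ?thesis
    using x y by (auto simp: S_def)
qed

section \<open>Charging supported points to net points\<close>

text \<open>This bounds how often a net point \<open>z\<close> of radius \<open>R\<close> is
  charged. Isolation radii in \<open>V\<close> are comparable to \<open>R\<close>, so
  \<open>V\<close> has diameter of order \<open>R\<close> but is separated at order
  \<open>R\<close>; each piece of a fine cover contains at most one of its points.\<close>

lemma separated_fibre_card_le:
  assumes "finite C" "C \<subseteq> M" "0 < \<delta>" "0 < R" "z \<in> M" "V \<subseteq> C"
    and K: "uniform_cover (\<delta> ^ 3 / 180) K"
    and V: "\<And>w. w \<in> V \<Longrightarrow> \<delta> * isolation_radius C w / 6 \<le> R \<and> R \<le> 3 * isolation_radius C w / \<delta> \<and>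
       d w z \<le> 4 * isolation_radius C w / \<delta>"
  shows "card V \<le> K"
proof -
  have VM: "V \<subseteq> M"
    using assms by blast
  have near: "d w z \<le> 24 * R / \<delta>\<^sup>2" if "w \<in> V" for w
  proof -
    have "isolation_radius C w \<le> 6 * R / \<delta>"
      using V[OF that] assms(3) by (simp add: field_simps)
    then have "4 * isolation_radius C w / \<delta> \<le> 4 * (6 * R / \<delta>) / \<delta>"
      using assms(3) by (intro divide_right_mono) auto
    then show ?thesis
      using V[OF that] by (simp add: power2_eq_square)
  qed
  have diam: "d v w \<le> 48 * R / \<delta>\<^sup>2" if vw: "v \<in> V" "w \<in> V" for v w
  proof -
    have "d v w \<le> d v z + d w z"
      using triangle[of v z w] vw VM assms(5) commute[of z w] by auto
    also have "\<dots> \<le> 24 * R / \<delta>\<^sup>2 + 24 * R / \<delta>\<^sup>2"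
      using near vw by (intro add_mono) auto
    finally show ?thesis
      by simp
  qed
  obtain \<F> where F: "finite \<F>" "card \<F> \<le> K" "V \<subseteq> \<Union>\<F>"
      "\<And>B x y. B \<in> \<F> \<Longrightarrow> x \<in> B \<Longrightarrow> y \<in> B \<Longrightarrow> d x y \<le> \<delta> ^ 3 / 180 * (48 * R / \<delta>\<^sup>2)"
    using uniform_coverD[OF K VM _ diam] assms(4) by (auto simp del: times_divide_eq_right)
  have "\<forall>v\<in>V. \<exists>B. B \<in> \<F> \<and> v \<in> B"
    using F(3) by blast
  then obtain g where g: "\<And>v. v \<in> V \<Longrightarrow> g v \<in> \<F> \<and> v \<in> g v"
    by metis
  have "inj_on g V"
  proof (rule inj_onI, rule ccontr)
    fix v w assume vw: "v \<in> V" "w \<in> V" "g v = g w" "v \<noteq> w"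
    have "d v w \<le> \<delta> ^ 3 / 180 * (48 * R / \<delta>\<^sup>2)"
      using F(4)[of "g v" v w] g[OF vw(1)] g[OF vw(2)] vw(3) by auto
    \<comment> \<open>The 180 is large enough for \<open>48 / 180 < 1/3\<close>, while isolation
      radii in \<open>V\<close> are at least \<open>\<delta> * R / 3\<close>.\<close>
    also have "\<dots> = 48 / 180 * (\<delta> * R)"
      using assms(3) by (simp add: field_simps power2_eq_square power3_eq_cube)
    also have "\<dots> < \<delta> * R / 3"
      using mult_pos_pos[OF assms(3,4)] by linarith
    also have "\<dots> \<le> isolation_radius C v"
      using V[OF vw(1)] assms(3) by (simp add: field_simps)
    also have "\<dots> \<le> d v w"
      using isolation_radius_le[of C w v] vw assms by blast
    finally show False by simp
  qed
  then have "card V \<le> card \<F>"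
    using g F(1) by (intro card_inj_on_le[of g]) auto
  then show ?thesis
    using F(2) by linarith
qed

text \<open>Supported points are mapped to \<open>P\<close>, which has at most
  \<open>K1 * card C / s\<close> elements, with fibres of size at most \<open>K2\<close>.\<close>

lemma supported_card_bound:
  assumes "finite C" "C \<subseteq> M" "0 < \<delta>" "\<delta> < 1" "0 < s" "0 < K1"
    and K1: "uniform_cover (\<delta>\<^sup>2 / 20) K1"
    and K2: "uniform_cover (\<delta> ^ 3 / 180) K2"
  shows "real (card {w \<in> C. supported \<delta> s C w}) \<le> real K1 * real K2 * real (card C) / s"
proof -
  define W where "W = {w \<in> C. supported \<delta> s C w}"
  define \<rho> where "\<rho> = isolation_radius C"
  have W: "W \<subseteq> C" "finite W"
    using assms(1) by (auto simp: W_def)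
  have \<rho>: "0 < \<rho> w" if "w \<in> W" for w
  proof -
    have "w \<in> C" "C - {w} \<noteq> {}"
      using that by (auto simp: W_def supported_def)
    then obtain v where "v \<in> C" "v \<noteq> w" "\<rho> w = d w v" "w \<in> C"
      using isolation_radius_attained[OF assms(1)] unfolding \<rho>_def by metis
    then show ?thesis
      using mdist_pos_less[of w v] subsetD[OF assms(2)] by auto
  qed
  define heavy where "heavy x r \<longleftrightarrow> s / real K1 \<le> real (card (mcball x r \<inter> C))" for x r
  define I where "I = {(x, r) \<in> C \<times> (\<lambda>w. \<delta> * \<rho> w / 10) ` W. heavy x r}"
  have "finite I"
  proof (rule finite_subset)
    show "I \<subseteq> C \<times> (\<lambda>w. \<delta> * \<rho> w / 10) ` W"
      unfolding I_def by blast
    show "finite (C \<times> (\<lambda>w. \<delta> * \<rho> w / 10) ` W)"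
      using W(2) assms(1) by simp
  qed
  moreover have "x \<in> C \<and> s / real K1 \<le> real (card (mcball x r \<inter> C))" if "(x, r) \<in> I" for x r
    using that by (simp add: I_def heavy_def)
  moreover have "0 < s / real K1"
    using assms(5,6) by simp
  ultimately obtain P where P: "P \<subseteq> C" "real (card P) * (s / real K1) \<le> real (card C)"
    "\<And>x r. (x, r) \<in> I \<Longrightarrow> \<exists>p\<in>P. d x p \<le> 2 * r"
    using heavy_balls_packing[OF assms(1,2), of I "s / real K1"] by metis
  have PM: "P \<subseteq> M" "finite P"
    using P(1) assms(1,2) by (auto dest: finite_subset)
  \<comment> \<open>For empty \<open>P\<close> this maximum is unspecified, but the bound on
    distances is then vacuous.\<close>
  define B where "B = Max (case_prod d ` (P \<times> P))"
  have B: "d x y \<le> B" if "x \<in> P" "y \<in> P" for x y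
    unfolding B_def using PM(2) that by (intro Max_ge) auto
  obtain R where sep: "\<And>x y. x \<in> P \<Longrightarrow> y \<in> P \<Longrightarrow> x \<noteq> y \<Longrightarrow> min (R x) (R y) \<le> d x y"
    and net: "\<And>p r. p \<in> P \<Longrightarrow> 0 < r \<Longrightarrow> r \<le> B \<Longrightarrow> \<exists>q\<in>P. r \<le> R q \<and> d p q < r"
    using farthest_first_radii[OF PM(2,1) B] by metis
  have "\<exists>z\<in>P. \<delta> * \<rho> w / 6 \<le> R z \<and> R z \<le> 3 * \<rho> w / \<delta> \<and> d w z \<le> 4 * \<rho> w / \<delta>" if w: "w \<in> W" for w
  proof -
    have "supported \<delta> s C w" "w \<in> M"
      using w assms(2) by (auto simp: W_def)
    then obtain x y where xy: "x \<in> C" "y \<in> C" "d w x < \<rho> w / \<delta>" "d w y < \<rho> w / \<delta>"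
        "\<delta> * \<rho> w \<le> d x y" "heavy x (\<delta> * \<rho> w / 10)" "heavy y (\<delta> * \<rho> w / 10)"
      using supported_two_heavy_balls[OF assms(1-3,5) _ K1, of w "\<rho> w"] \<rho>[OF w]
      unfolding heavy_def \<rho>_def by blast
    have "(x, \<delta> * \<rho> w / 10) \<in> I" "(y, \<delta> * \<rho> w / 10) \<in> I"
      using xy w by (auto simp: I_def)
    then obtain p q where pq: "p \<in> P" "d x p \<le> 2 * (\<delta> * \<rho> w / 10)"
        "q \<in> P" "d y q \<le> 2 * (\<delta> * \<rho> w / 10)"
      using P(3) by metis
    have M: "x \<in> M" "y \<in> M" "p \<in> M" "q \<in> M"
      using xy pq PM assms(2) by auto
    have \<delta>\<rho>: "0 < \<delta> * \<rho> w" "\<delta> * \<rho> w \<le> \<rho> w / \<delta>"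
    proof -
      have "\<delta> * \<rho> w \<le> \<rho> w"
        using \<rho>[OF w] assms by (simp add: mult_left_le_one_le)
      also have "\<dots> \<le> \<rho> w / \<delta>"
        using \<rho>[OF w] assms by (simp add: field_simps)
      finally show "\<delta> * \<rho> w \<le> \<rho> w / \<delta>" .
    qed (use \<rho>[OF w] assms in simp)
    have "d x y \<le> d x p + d p y" "d p y \<le> d p q + d q y" "d p q \<le> d p x + d x q"
         "d x q \<le> d x y + d y q" "d x y \<le> d x w + d w y"
      using M \<open>w \<in> M\<close> by (auto intro: triangle)
    \<comment> \<open>Replacing \<open>x\<close>, \<open>y\<close> by \<open>p\<close>,
      \<open>q\<close> moves each by at most \<open>\<delta> * \<rho> w / 5\<close>, so the distance
      changes by at most twice that.\<close>
    then have lower: "3/5 * (\<delta> * \<rho> w) \<le> d p q" and upper: "d p q \<le> 12/5 * (\<rho> w / \<delta>)"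
      using xy(3-5) pq(2,4) \<delta>\<rho> commute[of q y] commute[of p x] commute[of x w] by linarith+
    have "0 < \<delta> * \<rho> w / 6" "2 * (\<delta> * \<rho> w / 6) < d p q"
      using lower \<delta>\<rho> by linarith+
    then have "\<exists>z\<in>P. \<delta> * \<rho> w / 6 \<le> R z \<and> R z \<le> d p q + 2 * (\<delta> * \<rho> w / 6) \<and>
        d p z \<le> d p q + \<delta> * \<rho> w / 6"
      using radius_near_pair[where B = B and R = R, OF PM(1) pq(1,3)] B sep net by blast
    then obtain z where z: "z \<in> P" "\<delta> * \<rho> w / 6 \<le> R z" "R z \<le> d p q + 2 * (\<delta> * \<rho> w / 6)"
        "d p z \<le> d p q + \<delta> * \<rho> w / 6"
      by blast
    have "d w z \<le> d w x + d x z" "d x z \<le> d x p + d p z"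
      using M \<open>w \<in> M\<close> z PM by (auto intro: triangle)
    \<comment> \<open>In units of \<open>\<rho> w / \<delta>\<close>: \<open>12/5 + 1/3 < 3\<close>
      and \<open>1 + 1/5 + 12/5 + 1/6 < 4\<close>.\<close>
    then have "R z \<le> 3 * (\<rho> w / \<delta>)" "d w z \<le> 4 * (\<rho> w / \<delta>)"
      using z upper \<delta>\<rho> xy(3) pq(2) by linarith+
    then show ?thesis
      using z by (intro bexI[of _ z]) auto
  qed
  then obtain g where g: "\<And>w. w \<in> W \<Longrightarrow> g w \<in> P \<and> \<delta> * \<rho> w / 6 \<le> R (g w) \<and>
      R (g w) \<le> 3 * \<rho> w / \<delta> \<and> d w (g w) \<le> 4 * \<rho> w / \<delta>"
    by metis
  have fibre: "card {w \<in> W. g w = z} \<le> K2" if z: "z \<in> P" for z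
  \<comment> \<open>Positivity of \<open>R z\<close> is read off from a point charged to
    \<open>z\<close>.\<close>
  proof (cases "{w \<in> W. g w = z} = {}")
    case True
    show ?thesis unfolding True by simp
  next
    case False
    then obtain w where w: "w \<in> W" "g w = z" by blast
    then have "0 < \<delta> * \<rho> w / 6" "\<delta> * \<rho> w / 6 \<le> R z"
      using \<rho>[OF w(1)] assms(3) g[OF w(1)] by auto
    then have "0 < R z" by linarith
    then show ?thesis
      using z PM(1) W(1) g
      by (intro separated_fibre_card_le[OF assms(1-3) _ _ _ K2, of "R z" z]) (auto simp: \<rho>_def)
  qed
  have "W = (\<Union>z\<in>P. {w \<in> W. g w = z})"
    using g by blast
  then have "card W \<le> (\<Sum>z\<in>P. card {w \<in> W. g w = z})"
    using card_UN_le[OF PM(2), of "\<lambda>z. {w \<in> W. g w = z}"] by simp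
  also have "\<dots> \<le> card P * K2"
    using fibre sum_bounded_above[of P "\<lambda>z. card {w \<in> W. g w = z}" K2] by simp
  finally have "real (card W) \<le> real (card P) * real K2"
    by (metis of_nat_mono of_nat_mult)
  also have "\<dots> \<le> (real K1 * real (card C) / s) * real K2"
    using P(2) assms(5,6) by (intro mult_right_mono) (auto simp: field_simps)
  finally show ?thesis
    unfolding W_def by (simp add: mult_ac)
qed

lemma benjamini_schramm_if_doubling:
  assumes doubling
  shows benjamini_schramm
  unfolding benjamini_schramm_def
proof (intro allI impI)
  fix \<delta> :: real assume \<delta>: "0 < \<delta> \<and> \<delta> < 1"
  obtain K1 :: nat where K1: "uniform_cover (\<delta>\<^sup>2 / 20) K1"
    using uniform_cover_if_doubling[OF assms, of "\<delta>\<^sup>2 / 20"] \<delta> by auto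
  \<comment> \<open>The successor makes the constant positive, as division by it requires.\<close>
  have K1': "uniform_cover (\<delta>\<^sup>2 / 20) (Suc K1)"
    using K1 by (rule uniform_cover_mono) auto
  obtain K2 :: nat where K2: "uniform_cover (\<delta> ^ 3 / 180) K2"
    using uniform_cover_if_doubling[OF assms, of "\<delta> ^ 3 / 180"] \<delta> by auto
  show "\<exists>c::real. \<forall>C s. finite C \<and> C \<noteq> {} \<and> C \<subseteq> M \<and> 2 \<le> s \<longrightarrow>
          real (card {w \<in> C. supported \<delta> s C w}) < c * real (card C) / s"
  \<comment> \<open>The added 1 turns the bound into a strict one, since \<open>C\<close> is
    nonempty.\<close>
  proof (intro exI[of _ "real (Suc K1) * real K2 + 1"] allI impI)
    fix C and s :: real assume C: "finite C \<and> C \<noteq> {} \<and> C \<subseteq> M \<and> 2 \<le> s"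
    have "real (card {w \<in> C. supported \<delta> s C w}) \<le> real (Suc K1) * real K2 * real (card C) / s"
      using C \<delta> by (intro supported_card_bound K1' K2) auto
    also have "\<dots> < (real (Suc K1) * real K2 + 1) * real (card C) / s"
      using C by (intro divide_strict_right_mono mult_strict_right_mono) (auto simp: card_gt_0_iff)
    finally show "real (card {w \<in> C. supported \<delta> s C w}) < (real (Suc K1) * real K2 + 1) * real (card C) / s" .
  qed
qed

end

theorem theorem1:
  fixes M :: "'a set" and d :: "'a \<Rightarrow> 'a \<Rightarrow> real"
  assumes "Metric_space M d"
  shows "Metric_space.benjamini_schramm M d \<longleftrightarrow> Metric_space.doubling M d"
  using Metric_space.doubling_if_benjamini_schramm[OF assms]
    Metric_space.benjamini_schramm_if_doubling[OF assms] by blast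

end
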